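(* Let $N\ge 1$ and $N_r\ge 1$ be integers and consider the adaptive-rate cooperative ARQ protocol (described in the context) with $N$ transmission modes of rates $R_1,\dots,R_N>0$ and at most $N_r$ relay retransmissions per packet. Let $\varepsilon_n=\mathrm{PER}_n(\gamma_{sr})$ be the packet error rate of the source–relay channel in mode $n$, and for $l\ge 0$ and $\underline{m}^l=(m_1,\dots,m_l)\in\{1,\dots,N\}^l$ put $$L(n,\underline{m}^l)=\frac{1}{R_n}+\sum_{k=1}^{l}\frac{1}{R_{m_k}}.$$ Let $$P_n^{sd}=\int_{\gamma_{1,n}}^{\gamma_{1,n+1}}p_{\gamma_1}(\gamma)\,d\gamma,\qquad \overline{\mathrm{PER}}_n^{sd}=\frac{1}{P_n^{sd}}\int_{\gamma_{1,n}}^{\gamma_{1,n+1}}\mathrm{PER}_n(\gamma)\,p_{\gamma_1}(\gamma)\,d\gamma,$$ $$P_m^{rd}=\int_{\gamma_{2,m}}^{\gamma_{2,m+1}}p_{\gamma_2}(\gamma)\,d\gamma,\qquad \overline{\mathrm{PER}}_m^{rd}=\frac{1}{P_m^{rd}}\int_{\gamma_{2,m}}^{\gamma_{2,m+1}}\mathrm{PER}_m(\gamma)\,p_{\gamma_2}(\gamma)\,d\gamma .$$ Then the average spectral efficiency $\eta$ of the protocol is $$\eta=\sum_{n=1}^{N}\frac{1-(1-\varepsilon_n)\overline{\mathrm{PER}}_n^{sd}}{L(n,\underline{m}^0)}P_n^{sd} +\sum_{l=1}^{N_r-1}\sum_{n=1}^{N}\sum_{m_1=1}^{N}\cdots\sum_{m_l=1}^{N}\frac{1-\varepsilon_n}{L(n,\underline{m}^l)}\,\overline{\mathrm{PER}}_n^{sd}P_n^{sd}\left(\prod_{k=1}^{l-1}\overline{\mathrm{PER}}_{m_k}^{rd}P_{m_k}^{rd}\right)\bigl(1-\overline{\mathrm{PER}}_{m_l}^{rd}\bigr)P_{m_l}^{rd}$$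 $$\qquad+\sum_{n=1}^{N}\sum_{m_1=1}^{N}\cdots\sum_{m_{N_r}=1}^{N}\frac{(1-\varepsilon_n)\,\overline{\mathrm{PER}}_n^{sd}P_n^{sd}P_{m_{N_r}}^{rd}}{L(n,\underline{m}^{N_r})}\prod_{k=1}^{N_r-1}\overline{\mathrm{PER}}_{m_k}^{rd}P_{m_k}^{rd},$$ where empty sums are $0$ and empty products are $1$.
   Context: Channel model. There are a source S, a relay R and a destination D. The S–D signal-to-noise ratio (SNR) $\gamma_1$ and the R–D SNR $\gamma_2$ are random with densities $p_{\gamma_1},p_{\gamma_2}$; under Rayleigh fading they are exponential with means $\bar\gamma_1,\bar\gamma_2>0$. Fading is block fading: the SNR is constant during the transmission of a packet and takes independent values in different transmissions. Thus a packet meets independent SNRs $\gamma_1,\gamma_2^1,\dots,\gamma_2^{N_r}$, where $\gamma_1$ is for the source transmission and $\gamma_2^k$, distributed as $\gamma_2$, is for the $k$-th relay retransmission. The S–R channel has a fixed SNR $\gamma_{sr}>0$. Adaptive modulation and coding. There are thresholds $0=\gamma_{i,0}<\gamma_{i,1}<\dots<\gamma_{i,N}<\gamma_{i,N+1}=\infty$ for $i=1,2$. The source uses mode $n$ (rate $R_n$ bits/symbol) when $\gamma_1\in[\gamma_{1,n},\gamma_{1,n+1})$, and the relay uses mode $m$ (rate $R_m$) in a retransmission when its SNR lies in $[\gamma_{2,m},\gamma_{2,m+1})$. Mode $0$ is an outage mode: nothing is transmitted, i.e. $R_0=0$. Packet errors. $\mathrm{PER}_n(\gamma)\in[0,1]$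 is the probability that a packet sent in mode $n\ge1$ over a channel of SNR $\gamma$ is received in error (a measurable function of $\gamma$; it is modelled as $\mathrm{PER}_n(\gamma)=1$ for $\gamma<\Gamma_n$ and $\mathrm{PER}_n(\gamma)=a_n e^{-g_n\gamma}$ for $\gamma\ge\Gamma_n$ with fixed parameters $a_n,g_n,\Gamma_n$). Given all SNRs, the error events of the different transmissions, and of the reception at D and at R of the same source transmission, are independent. Error detection and feedback are perfect. Protocol. The source sends a packet in mode $n$ to both R and D; D receives it in error with probability $\mathrm{PER}_n(\gamma_1)$ and R receives it in error with probability $\varepsilon_n=\mathrm{PER}_n(\gamma_{sr})$. If D receives the packet correctly, or if D fails and R also fails, there is no retransmission. If D fails and R succeeds, R retransmits the packet, using at the $k$-th retransmission the mode $m_k$ determined by $\gamma_2^k$, until D receives it correctly or $N_r$ retransmissions have been made. Spectral efficiency. Each packet has a fixed number $N_P$ of bits, so a transmission in mode $n\ge 1$ takes $N_P/R_n$ symbols. If $L$ denotes the total number of symbols used for a packet (source transmission plus all relay retransmissions made), the average spectral efficiency is $\eta=\mathbb{E}[N_P/L]$, the expectation being over the SNRs and the transmission errors. Convention: if the source transmission or a required relay retransmission meets an outage mode, then $L=\infty$ (as $1/R_0=\infty$) and $N_P/L=0$. *)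

theory Defs
  imports "HOL-Probability.Probability"
begin

text \<open>
  The three kinds of reception: of the source transmission at the relay (\<open>SR\<close>), of the source
  transmission at the destination (\<open>SD\<close>), and of the \<open>k\<close>-th relay retransmission at the
  destination (\<open>RD k\<close>, \<open>k \<ge> 1\<close>).
\<close>
datatype reception = SR | SD | RD nat

definition receptions :: "nat \<Rightarrow> reception set" where
  "receptions Nr = {SR, SD} \<union> RD ` {1..Nr}"

text \<open>
  Thresholds are extended reals, so that the last one can be infinite. For \<open>x < 0\<close> the mode is
  unspecified; SNRs are almost surely nonnegative.
\<close>
definition snr_interval :: "(nat \<Rightarrow> ereal) \<Rightarrow> nat \<Rightarrow> real set" where
  "snr_interval th n = {x. th n \<le> ereal x \<and> ereal x < th (Suc n)}"

definition mode :: "nat \<Rightarrow> (nat \<Rightarrow> ereal) \<Rightarrow> real \<Rightarrow> nat" where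
  "mode N th x = (THE n. n \<le> N \<and> x \<in> snr_interval th n)"

definition thresholds :: "nat \<Rightarrow> (nat \<Rightarrow> ereal) \<Rightarrow> bool" where
  "thresholds N th \<longleftrightarrow> th 0 = 0 \<and> th (Suc N) = \<infinity> \<and> (\<forall>n\<le>N. th n < th (Suc n))"

definition mode_prob :: "(real \<Rightarrow> real) \<Rightarrow> (nat \<Rightarrow> ereal) \<Rightarrow> nat \<Rightarrow> real" where
  "mode_prob p th n = (LINT x:snr_interval th n|lborel. p x)"

text \<open>
  For densities vanishing on a mode interval the quotient is \<open>0 / 0 = 0\<close>; for exponential
  densities all mode probabilities are positive.
\<close>
definition avg_PER ::
    "(real \<Rightarrow> real) \<Rightarrow> (nat \<Rightarrow> ereal) \<Rightarrow> (nat \<Rightarrow> real \<Rightarrow> real) \<Rightarrow> nat \<Rightarrow> real" where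
  "avg_PER p th PER n =
     1 / mode_prob p th n * (LINT x:snr_interval th n|lborel. PER n x * p x)"

definition symbols_per_bit :: "(nat \<Rightarrow> real) \<Rightarrow> nat \<Rightarrow> nat \<Rightarrow> (nat \<Rightarrow> nat) \<Rightarrow> real" where
  "symbols_per_bit R n l m = 1 / R n + (\<Sum>k=1..l. 1 / R (m k))"

text \<open>All SNRs met by a packet: index \<open>0\<close> is the source transmission.\<close>
definition packet_snr :: "('w \<Rightarrow> real) \<Rightarrow> (nat \<Rightarrow> 'w \<Rightarrow> real) \<Rightarrow> nat \<Rightarrow> 'w \<Rightarrow> real" where
  "packet_snr \<gamma>1 \<gamma>2 k = (if k = 0 then \<gamma>1 else \<gamma>2 k)"

definition snr_algebra ::
    "'w measure \<Rightarrow> nat \<Rightarrow> ('w \<Rightarrow> real) \<Rightarrow> (nat \<Rightarrow> 'w \<Rightarrow> real) \<Rightarrow> 'w measure" where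
  "snr_algebra M Nr \<gamma>1 \<gamma>2 =
     vimage_algebra (space M) (\<lambda>\<omega>. \<lambda>k\<in>{0..Nr}. packet_snr \<gamma>1 \<gamma>2 k \<omega>)
       (Pi\<^sub>M {0..Nr} (\<lambda>_. borel))"

text \<open>
  \<open>err r\<close> is the event that the reception \<open>r\<close> would be in error. The events \<open>err (RD k)\<close> are
  defined for all \<open>k \<le> Nr\<close>, whether or not the \<open>k\<close>-th retransmission takes place; the protocol
  below consults only those of retransmissions that are made. In mode \<open>0\<close> nothing is sent and
  the conditional error probability is left unconstrained.
\<close>
locale cooperative_arq = prob_space M
  for M :: "'w measure" +
  fixes N Nr NP :: nat
    and R :: "nat \<Rightarrow> real"
    and th1 th2 :: "nat \<Rightarrow> ereal"
    and p1 p2 :: "real \<Rightarrow> real"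
    and PER :: "nat \<Rightarrow> real \<Rightarrow> real"
    and \<gamma>sr :: real
    and \<gamma>1 :: "'w \<Rightarrow> real"
    and \<gamma>2 :: "nat \<Rightarrow> 'w \<Rightarrow> real"
    and err :: "reception \<Rightarrow> 'w set"
  assumes N_ge_1: "1 \<le> N"
    and Nr_ge_1: "1 \<le> Nr"
    and NP_pos: "0 < NP"
    and rate_outage: "R 0 = 0"
    and rate_pos: "\<And>n. n \<in> {1..N} \<Longrightarrow> 0 < R n"
    and thresholds_sd: "thresholds N th1"
    and thresholds_rd: "thresholds N th2"
    and PER_measurable: "\<And>n. n \<in> {1..N} \<Longrightarrow> PER n \<in> borel_measurable borel"
    and PER_range: "\<And>n x. n \<in> {1..N} \<Longrightarrow> PER n x \<in> {0..1}"
    and snr_sr_pos: "0 < \<gamma>sr"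
    and density_sd_nonneg: "\<And>x. 0 \<le> p1 x"
    and density_rd_nonneg: "\<And>x. 0 \<le> p2 x"
    and density_sd_support: "\<And>x. x < 0 \<Longrightarrow> p1 x = 0"
    and density_rd_support: "\<And>x. x < 0 \<Longrightarrow> p2 x = 0"
    and snr_sd_distributed: "distributed M lborel \<gamma>1 (\<lambda>x. ennreal (p1 x))"
    and snr_rd_distributed:
      "\<And>k. k \<in> {1..Nr} \<Longrightarrow> distributed M lborel (\<gamma>2 k) (\<lambda>x. ennreal (p2 x))"
    and snr_indep: "indep_vars (\<lambda>_. borel) (packet_snr \<gamma>1 \<gamma>2) {0..Nr}"
    and err_events: "\<And>r. r \<in> receptions Nr \<Longrightarrow> err r \<in> events"
    and err_cond_indep: "\<And>J. J \<subseteq> receptions Nr \<Longrightarrow> J \<noteq> {} \<Longrightarrow>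
      AE \<omega> in M. real_cond_exp M (snr_algebra M Nr \<gamma>1 \<gamma>2) (indicator (\<Inter>r\<in>J. err r)) \<omega> =
        (\<Prod>r\<in>J. real_cond_exp M (snr_algebra M Nr \<gamma>1 \<gamma>2) (indicator (err r)) \<omega>)"
    and err_prob_sr:
      "AE \<omega> in M. mode N th1 (\<gamma>1 \<omega>) \<in> {1..N} \<longrightarrow>
        real_cond_exp M (snr_algebra M Nr \<gamma>1 \<gamma>2) (indicator (err SR)) \<omega> =
          PER (mode N th1 (\<gamma>1 \<omega>)) \<gamma>sr"
    and err_prob_sd:
      "AE \<omega> in M. mode N th1 (\<gamma>1 \<omega>) \<in> {1..N} \<longrightarrow>
        real_cond_exp M (snr_algebra M Nr \<gamma>1 \<gamma>2) (indicator (err SD)) \<omega> =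
          PER (mode N th1 (\<gamma>1 \<omega>)) (\<gamma>1 \<omega>)"
    and err_prob_rd: "\<And>k. k \<in> {1..Nr} \<Longrightarrow>
      AE \<omega> in M. mode N th2 (\<gamma>2 k \<omega>) \<in> {1..N} \<longrightarrow>
        real_cond_exp M (snr_algebra M Nr \<gamma>1 \<gamma>2) (indicator (err (RD k))) \<omega> =
          PER (mode N th2 (\<gamma>2 k \<omega>)) (\<gamma>2 k \<omega>)"

definition retransmissions :: "nat \<Rightarrow> (reception \<Rightarrow> 'w set) \<Rightarrow> 'w \<Rightarrow> nat set" where
  "retransmissions Nr err \<omega> =
     {k \<in> {1..Nr}. \<omega> \<in> err SD \<and> \<omega> \<notin> err SR \<and> (\<forall>j\<in>{1..<k}. \<omega> \<in> err (RD j))}"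

text \<open>
  With \<open>R 0 = 0\<close>, division in \<^typ>\<open>ennreal\<close> makes the number of symbols infinite as soon as the
  source transmission or a retransmission that is made meets the outage mode, and then
  \<open>NP / total_symbols\<close> is \<open>0\<close>.
\<close>
definition total_symbols ::
    "nat \<Rightarrow> nat \<Rightarrow> nat \<Rightarrow> (nat \<Rightarrow> real) \<Rightarrow> (nat \<Rightarrow> ereal) \<Rightarrow> (nat \<Rightarrow> ereal) \<Rightarrow>
     ('w \<Rightarrow> real) \<Rightarrow> (nat \<Rightarrow> 'w \<Rightarrow> real) \<Rightarrow> (reception \<Rightarrow> 'w set) \<Rightarrow> 'w \<Rightarrow> ennreal" where
  "total_symbols N Nr NP R th1 th2 \<gamma>1 \<gamma>2 err \<omega> =
     ennreal (real NP) / ennreal (R (mode N th1 (\<gamma>1 \<omega>))) +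
     (\<Sum>k\<in>retransmissions Nr err \<omega>.
        ennreal (real NP) / ennreal (R (mode N th2 (\<gamma>2 k \<omega>))))"

definition avg_spectral_efficiency ::
    "'w measure \<Rightarrow> nat \<Rightarrow> nat \<Rightarrow> nat \<Rightarrow> (nat \<Rightarrow> real) \<Rightarrow> (nat \<Rightarrow> ereal) \<Rightarrow> (nat \<Rightarrow> ereal) \<Rightarrow>
     ('w \<Rightarrow> real) \<Rightarrow> (nat \<Rightarrow> 'w \<Rightarrow> real) \<Rightarrow> (reception \<Rightarrow> 'w set) \<Rightarrow> real" where
  "avg_spectral_efficiency M N Nr NP R th1 th2 \<gamma>1 \<gamma>2 err =
     prob_space.expectation M
       (\<lambda>\<omega>. enn2real (ennreal (real NP) / total_symbols N Nr NP R th1 th2 \<gamma>1 \<gamma>2 err \<omega>))"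

end

theory Submission
  imports Defs
begin

text \<open>
  Up to a null set, \<open>NP / total_symbols\<close> is a finite sum over the number \<open>l\<close> of retransmissions and the
  modes \<open>n, m 1, \<dots>, m l\<close>: the term is \<open>1 / L(n, m)\<close> times the indicator that these modes occur, times
  the indicator that exactly \<open>l\<close> retransmissions are made. Outage paths contribute \<open>0\<close>. The second
  indicator is a product of indicators of error events and of their complements (for \<open>l = 0\<close>, one
  minus such a product). Conditioning on the SNRs replaces each error indicator by a packet error
  rate, since the mode indicator is measurable with respect to the SNRs. What remains is a
  product of functions of independent SNRs, whose expectation is the product of the integrals
  against the densities.
\<close>

section \<open>Thresholds, mode intervals and measurability of the mode\<close>

lemma thresholds_less:
  assumes "thresholds N th" "i < j" "j \<le> Suc N"
  shows "th i < th j"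
  using assms(2,3)
proof (induction j)
  case (Suc j)
  have step: "th j < th (Suc j)"
    using assms(1) Suc.prems by (auto simp: thresholds_def)
  show ?case
  proof (cases "i = j")
    case False
    then have "th i < th j" using Suc by simp
    with step show ?thesis by order
  qed (use step in simp)
qed simp

text \<open>By strict monotonicity of the thresholds the mode intervals are pairwise disjoint, so
  the description defining \<open>mode\<close> has at most one solution.\<close>

lemma mode_eqI:
  assumes "thresholds N th" "n \<le> N" "x \<in> snr_interval th n"
  shows "mode N th x = n"
  unfolding mode_def
proof (rule the_equality)
  fix n' assume n': "n' \<le> N \<and> x \<in> snr_interval th n'"
  have "\<not> (i < j \<and> i \<le> N \<and> j \<le> N \<and> x \<in> snr_interval th i \<and> x \<in> snr_interval th j)" for i j
  proof
    assume *: "i < j \<and> i \<le> N \<and> j \<le> N \<and> x \<in> snr_interval th i \<and> x \<in> snr_interval th j"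
    then have "th (Suc i) \<le> th j"
      using thresholds_less[OF assms(1), of "Suc i" j] by (cases "Suc i = j") auto
    with * show False by (auto simp: snr_interval_def)
  qed
  from this[of n n'] this[of n' n] show "n' = n" using n' assms by (cases n n' rule: linorder_cases) auto
qed (use assms in auto)

lemma mode_in_snr_interval:
  assumes "thresholds N th" "0 \<le> x"
  shows "mode N th x \<le> N" "x \<in> snr_interval th (mode N th x)"
proof -
  \<comment> \<open>The mode is the largest index whose threshold does not exceed \<open>x\<close>.
    Index 0 is a candidate since \<open>th 0 = 0\<close>; the upper bound holds by maximality, or
    for \<open>n = N\<close> because the last threshold is infinite.\<close>
  define n where "n = Max {n. n \<le> N \<and> th n \<le> ereal x}"
  have ne: "0 \<in> {n. n \<le> N \<and> th n \<le> ereal x}" using assms by (auto simp: thresholds_def)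
  have fin: "finite {n. n \<le> N \<and> th n \<le> ereal x}" by simp
  have n: "n \<le> N" "th n \<le> ereal x" using Max_in[OF fin] ne unfolding n_def by blast+
  have "ereal x < th (Suc n)"
  proof (cases "n = N")
    case True then show ?thesis using assms by (auto simp: thresholds_def)
  next
    case False
    have "\<not> th (Suc n) \<le> ereal x"
    proof
      assume "th (Suc n) \<le> ereal x"
      then have "Suc n \<le> n" using Max_ge[OF fin, of "Suc n"] n False unfolding n_def by auto
      then show False by simp
    qed
    then show ?thesis by simp
  qed
  then have "x \<in> snr_interval th n" using n by (auto simp: snr_interval_def)
  moreover from this have "mode N th x = n" using assms n by (intro mode_eqI)
  ultimately show "mode N th x \<le> N" "x \<in> snr_interval th (mode N th x)" using n by auto
qed

lemma mode_eq_iff: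
  assumes "thresholds N th" "0 \<le> x" "n \<le> N"
  shows "mode N th x = n \<longleftrightarrow> x \<in> snr_interval th n"
  using mode_eqI[OF assms(1,3)] mode_in_snr_interval[OF assms(1,2)] by blast

text \<open>
  Needed only for measurability: on negative SNRs the description operator in \<^const>\<open>mode\<close> has an
  unsatisfiable predicate, but always the same one.
\<close>
lemma mode_neg:
  assumes "thresholds N th" "x < 0"
  shows "mode N th x = (THE n. False)"
proof -
  have "x \<notin> snr_interval th n" if "n \<le> N" for n
  proof -
    have "0 \<le> th n"
      using thresholds_less[OF assms(1), of 0 n] that assms(1) by (cases n) (auto simp: thresholds_def less_imp_le)
    moreover have "ereal x < 0" using assms(2) by simp
    ultimately have "ereal x < th n" by order
    then show ?thesis by (auto simp: snr_interval_def)
  qed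
  then show ?thesis unfolding mode_def by (intro arg_cong[of _ _ The]) auto
qed

lemma snr_interval_borel [measurable]: "snr_interval th n \<in> sets borel"
  unfolding snr_interval_def by measurable

lemma mode_measurable:
  assumes "thresholds N th"
  shows "mode N th \<in> borel \<rightarrow>\<^sub>M count_space UNIV"
proof (subst measurable_count_space_eq2_countable)
  \<comment> \<open>The preimage is split by the sign of \<open>x\<close>: on the negative half-line
    the mode is one unspecified constant, elsewhere it is decided by the mode intervals.\<close>
  have "mode N th -` {n} = ({x. x < 0} \<inter> {x. n = (THE n. False)}) \<union> ({x. 0 \<le> x} \<inter> snr_interval th n \<inter> {x. n \<le> N})" for n
  proof (intro set_eqI)
    fix x
    show "x \<in> mode N th -` {n} \<longleftrightarrow>
        x \<in> ({x. x < 0} \<inter> {x. n = (THE n. False)}) \<union> ({x. 0 \<le> x} \<inter> snr_interval th n \<inter> {x. n \<le> N})"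
      using mode_neg[OF assms, of x] mode_eqI[OF assms, of n x] mode_in_snr_interval[OF assms, of x]
      by (cases "x < 0") auto
  qed
  moreover have "({x::real. x < 0} \<inter> {x. n = (THE n. False)}) \<union> ({x. 0 \<le> x} \<inter> snr_interval th n \<inter> {x. n \<le> N}) \<in> sets borel" for n
    by measurable
  ultimately show "mode N th \<in> space borel \<rightarrow> UNIV \<and> (\<forall>n\<in>UNIV. mode N th -` {n} \<inter> space borel \<in> sets borel)"
    by simp
qed

lemma prod_indicator_eq:
  assumes "finite A"
  shows "(\<Prod>r\<in>A. indicator (B r) x) = (of_bool (\<forall>r\<in>A. x \<in> B r) :: real)"
    "(\<Prod>r\<in>A. 1 - indicator (B r) x) = (of_bool (\<forall>r\<in>A. x \<notin> B r) :: real)"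
  using assms by (induction rule: finite_induct) (simp_all add: indicator_def)

section \<open>Expectations of functions of an SNR with a given density\<close>

lemma density_measurable:
  assumes "distributed M lborel X (\<lambda>x. ennreal (p x))" "\<And>x. 0 \<le> p x"
  shows "p \<in> borel_measurable borel"
  using distributed_real_measurable[of lborel p M X] assms by simp

lemma (in prob_space) expectation_density:
  assumes "distributed M lborel X (\<lambda>x. ennreal (p x))" "\<And>x. 0 \<le> p x"
    "u \<in> borel_measurable borel"
  shows "expectation (\<lambda>\<omega>. u (X \<omega>)) = (LINT x|lborel. p x * u x)"
  using distributed_integral[OF assms(1), of u] assms by simp

lemma (in prob_space) AE_nonneg_of_density:
  fixes X :: "'a \<Rightarrow> real"
  assumes "distributed M lborel X (\<lambda>x. ennreal (p x))" "\<And>x. x < 0 \<Longrightarrow> p x = 0"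
  shows "AE \<omega> in M. 0 \<le> X \<omega>"
proof -
  have "AE x in lborel. 0 < ennreal (p x) \<longrightarrow> 0 \<le> x"
  proof (rule AE_I2)
    fix x show "0 < ennreal (p x) \<longrightarrow> 0 \<le> x"
      using assms(2)[of x] by (cases "x < 0") auto
  qed
  moreover have "Measurable.pred lborel (\<lambda>x::real. 0 \<le> x)" by measurable
  ultimately show ?thesis using distributed_AE2[OF assms(1), of "\<lambda>x. 0 \<le> x"] by blast
qed

lemma (in prob_space) density_integrable:
  assumes "distributed M lborel X (\<lambda>x. ennreal (p x))" "\<And>x. 0 \<le> p x"
  shows "integrable lborel p"
proof -
  have [measurable]: "X \<in> borel_measurable M" using assms(1) by (auto simp: distributed_def)
  have "(\<integral>\<^sup>+x. ennreal (p x) * 1 \<partial>lborel) = (\<integral>\<^sup>+\<omega>. 1 \<partial>M)"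
    using assms(1) by (rule distributed_nn_integral) simp
  then show ?thesis
    using assms density_measurable[OF assms] by (intro integrableI_nn_integral_finite[where x=1]) (auto simp: emeasure_space_1)
qed

lemma (in prob_space) expectation_mode:
  assumes "distributed M lborel X (\<lambda>x. ennreal (p x))" "\<And>x. 0 \<le> p x"
  shows "expectation (\<lambda>\<omega>. indicator (snr_interval th n) (X \<omega>)) = mode_prob p th n"
  using expectation_density[OF assms, of "indicator (snr_interval th n)"]
  by (simp add: mode_prob_def set_lebesgue_integral_def mult.commute)

text \<open>Division by zero is harmless: if the mode probability is 0, the nonnegative density
  vanishes almost everywhere on the interval, so the integral on the right is 0 as well.\<close>

lemma mode_prob_mult_avg_PER:
  assumes "\<And>x. 0 \<le> p x" "integrable lborel p"
  shows "avg_PER p th PER n * mode_prob p th n = (LINT x:snr_interval th n|lborel. PER n x * p x)"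
proof (cases "mode_prob p th n = 0")
  case True
  have "AE x in lborel. indicator (snr_interval th n) x * p x = 0"
    using True assms unfolding mode_prob_def set_lebesgue_integral_def
    by (subst (asm) integral_nonneg_eq_0_iff_AE) (auto intro: integrable_mult_indicator[of _ lborel p, simplified])
  then have "(LINT x:snr_interval th n|lborel. PER n x * p x) = 0"
    unfolding set_lebesgue_integral_def
    by (intro integral_eq_zero_AE) (auto elim!: eventually_mono)
  with True show ?thesis by simp
qed (simp add: avg_PER_def)

section \<open>The sigma-algebra generated by the SNRs, and paths of modes\<close>

context cooperative_arq
begin

abbreviation "snr \<equiv> packet_snr \<gamma>1 \<gamma>2"
abbreviation "snr_alg \<equiv> snr_algebra M Nr \<gamma>1 \<gamma>2"

lemma snr_measurable: "k \<le> Nr \<Longrightarrow> snr k \<in> borel_measurable M"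
  using snr_indep by (auto simp: indep_vars_def)

lemma snr_sd_measurable [measurable]: "\<gamma>1 \<in> borel_measurable M"
  using snr_measurable[of 0] by (simp add: packet_snr_def)

lemma snr_rd_measurable: "k \<in> {1..Nr} \<Longrightarrow> \<gamma>2 k \<in> borel_measurable M"
  using snr_measurable[of k] by (simp add: packet_snr_def)

lemma snr_measurable_snr_alg:
  assumes "k \<le> Nr"
  shows "snr k \<in> borel_measurable snr_alg"
proof -
  have "(\<lambda>\<omega>. \<lambda>k\<in>{0..Nr}. snr k \<omega>) \<in> measurable snr_alg (Pi\<^sub>M {0..Nr} (\<lambda>_. borel))"
    unfolding snr_algebra_def by (rule measurable_vimage_algebra1) (auto simp: space_PiM)
  from measurable_compose[OF this measurable_component_singleton[of k]] assms
  show ?thesis by simp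
qed

lemma snr_sd_measurable_snr_alg: "\<gamma>1 \<in> borel_measurable snr_alg"
  using snr_measurable_snr_alg[of 0] by (simp add: packet_snr_def)

lemma snr_rd_measurable_snr_alg: "k \<in> {1..Nr} \<Longrightarrow> \<gamma>2 k \<in> borel_measurable snr_alg"
  using snr_measurable_snr_alg[of k] by (simp add: packet_snr_def)

lemma subalgebra_snr_alg: "subalgebra M snr_alg"
proof -
  have "(\<lambda>\<omega>. \<lambda>k\<in>{0..Nr}. snr k \<omega>) \<in> measurable M (Pi\<^sub>M {0..Nr} (\<lambda>_. borel))"
    using snr_measurable by (intro measurable_restrict) auto
  then have "sets snr_alg \<subseteq> sets M"
    unfolding snr_algebra_def sets_vimage_algebra
    by (intro sets.sigma_sets_subset) (auto intro: measurable_sets)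
  then show ?thesis by (simp add: subalgebra_def snr_algebra_def)
qed

text \<open>
  Indicator of the event that the source uses mode \<open>n\<close> and the first \<open>l\<close> retransmissions would use the
  modes \<open>m 1, \<dots>, m l\<close>, whether or not they are made.
\<close>
definition path_ind :: "nat \<Rightarrow> nat \<Rightarrow> (nat \<Rightarrow> nat) \<Rightarrow> 'w \<Rightarrow> real" where
  "path_ind n l m \<omega> = indicator (snr_interval th1 n) (\<gamma>1 \<omega>) *
     (\<Prod>k=1..l. indicator (snr_interval th2 (m k)) (\<gamma>2 k \<omega>))"

text \<open>The modes are the parameters \<open>n\<close> and \<open>m\<close>, not the modes
  actually met at \<omega>. This makes each value a function of at most one SNR; the two choices of
  modes agree where \<open>path_ind\<close> is nonzero.\<close>

definition path_PER :: "nat \<Rightarrow> (nat \<Rightarrow> nat) \<Rightarrow> reception \<Rightarrow> 'w \<Rightarrow> real" where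
  "path_PER n m r \<omega> =
     (case r of SR \<Rightarrow> PER n \<gamma>sr | SD \<Rightarrow> PER n (\<gamma>1 \<omega>) | RD k \<Rightarrow> PER (m k) (\<gamma>2 k \<omega>))"

lemma path_ind_measurable_snr_alg:
  assumes "l \<le> Nr"
  shows "path_ind n l m \<in> borel_measurable snr_alg"
proof -
  note [measurable] = snr_sd_measurable_snr_alg
  have [measurable]: "\<gamma>2 k \<in> borel_measurable snr_alg" if "k \<in> {1..l}" for k
    using that assms by (intro snr_rd_measurable_snr_alg) auto
  show ?thesis unfolding path_ind_def by measurable
qed

lemma path_ind_bounds: "0 \<le> path_ind n l m \<omega>" "path_ind n l m \<omega> \<le> 1"
  unfolding path_ind_def
  by (auto intro!: mult_nonneg_nonneg prod_nonneg mult_le_one prod_le_1 simp: indicator_def)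

lemma path_ind_measurable:
  assumes "l \<le> Nr"
  shows "path_ind n l m \<in> borel_measurable M"
  using path_ind_measurable_snr_alg[OF assms] by (rule measurable_from_subalg[OF subalgebra_snr_alg])

lemma path_PER_measurable:
  assumes "n \<in> {1..N}" "l \<le> Nr" "\<And>k. k \<in> {1..l} \<Longrightarrow> m k \<in> {1..N}"
    "r \<in> {SR, SD} \<union> RD ` {1..l}"
  shows "path_PER n m r \<in> borel_measurable M"
proof (cases r)
  case (RD k)
  then have k: "k \<in> {1..l}" using assms by auto
  then have "\<gamma>2 k \<in> borel_measurable M" using assms by (intro snr_rd_measurable) auto
  from measurable_compose[OF this PER_measurable[OF assms(3)[OF k]]] show ?thesis
    by (simp add: path_PER_def[abs_def] RD)
qed (use measurable_compose[OF snr_sd_measurable PER_measurable[OF assms(1)]] in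
      \<open>simp_all add: path_PER_def[abs_def]\<close>)

lemma path_PER_range:
  assumes "n \<in> {1..N}" "\<And>k. k \<in> {1..l} \<Longrightarrow> m k \<in> {1..N}" "r \<in> {SR, SD} \<union> RD ` {1..l}"
  shows "path_PER n m r \<omega> \<in> {0..1}"
proof (cases r)
  case (RD k)
  then show ?thesis using PER_range[OF assms(2)[of k]] assms(3) by (auto simp: path_PER_def)
qed (use PER_range[OF assms(1)] in \<open>simp_all add: path_PER_def\<close>)

section \<open>Replacing error indicators by error rates through conditioning on the SNRs\<close>

lemma cond_error_prob:
  assumes "n \<in> {1..N}" "l \<le> Nr" "\<And>k. k \<in> {1..l} \<Longrightarrow> m k \<in> {1..N}"
    "r \<in> {SR, SD} \<union> RD ` {1..l}"
  shows "AE \<omega> in M. path_ind n l m \<omega> \<noteq> 0 \<longrightarrow>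
           real_cond_exp M snr_alg (indicator (err r)) \<omega> = path_PER n m r \<omega>"
proof -
  \<comment> \<open>Where \<open>path_ind\<close> is nonzero, the SNRs of the path lie in the
    prescribed intervals, so the modes met are \<open>n\<close> and \<open>m k\<close>. None of them
    is the outage mode, hence the assumptions on conditional error probabilities apply.\<close>
  have sd: "mode N th1 (\<gamma>1 \<omega>) = n" if "path_ind n l m \<omega> \<noteq> 0" for \<omega>
    using that assms(1) by (intro mode_eqI thresholds_sd) (auto simp: path_ind_def indicator_def split: if_splits)
  have rd: "mode N th2 (\<gamma>2 k \<omega>) = m k" if "path_ind n l m \<omega> \<noteq> 0" "k \<in> {1..l}" for k \<omega>
    using that assms(3)[OF that(2)]
    by (intro mode_eqI thresholds_rd) (auto simp: path_ind_def indicator_def split: if_splits)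
  show ?thesis
  proof (cases r)
    case SR
    show ?thesis using err_prob_sr by eventually_elim (use sd assms(1) in \<open>auto simp: SR path_PER_def\<close>)
  next
    case SD
    show ?thesis using err_prob_sd by eventually_elim (use sd assms(1) in \<open>auto simp: SD path_PER_def\<close>)
  next
    case (RD k)
    then have k: "k \<in> {1..l}" "k \<in> {1..Nr}" using assms by auto
    show ?thesis using err_prob_rd[OF k(2)]
      by eventually_elim (use rd[OF _ k(1)] assms(3)[OF k(1)] in \<open>auto simp: RD path_PER_def\<close>)
  qed
qed

lemma receptions_subset: "l \<le> Nr \<Longrightarrow> {SR, SD} \<union> RD ` {1..l} \<subseteq> receptions Nr"
  unfolding receptions_def by (intro Un_mono image_mono) auto

text \<open>Every factor lies between 0 and 1. The family \<open>f\<close> is left general so as to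
  cover both the error indicators and the error rates \<open>path_PER\<close>.\<close>

lemma integrable_bounded_prod:
  fixes f :: "'i \<Rightarrow> 'w \<Rightarrow> real"
  assumes "l \<le> Nr" "finite J" "finite K"
    and "\<And>r. r \<in> J \<union> K \<Longrightarrow> f r \<in> borel_measurable M" "\<And>r \<omega>. r \<in> J \<union> K \<Longrightarrow> f r \<omega> \<in> {0..1}"
  shows "integrable M (\<lambda>\<omega>. path_ind n l m \<omega> * (\<Prod>r\<in>J. f r \<omega>) * (\<Prod>r\<in>K. 1 - f r \<omega>))"
proof (rule integrable_const_bound[where B=1])
  note [measurable] = path_ind_measurable[OF assms(1)] assms(4)
  show "(\<lambda>\<omega>. path_ind n l m \<omega> * (\<Prod>r\<in>J. f r \<omega>) * (\<Prod>r\<in>K. 1 - f r \<omega>)) \<in> borel_measurable M"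
    by (intro borel_measurable_times borel_measurable_prod borel_measurable_diff) (auto intro!: assms path_ind_measurable)
  show "AE \<omega> in M. norm (path_ind n l m \<omega> * (\<Prod>r\<in>J. f r \<omega>) * (\<Prod>r\<in>K. 1 - f r \<omega>)) \<le> 1"
  proof (rule AE_I2)
    fix \<omega>
    have "0 \<le> (\<Prod>r\<in>J. f r \<omega>) \<and> (\<Prod>r\<in>J. f r \<omega>) \<le> 1" "0 \<le> (\<Prod>r\<in>K. 1 - f r \<omega>) \<and> (\<Prod>r\<in>K. 1 - f r \<omega>) \<le> 1"
      using assms(5) by (auto intro!: prod_nonneg prod_le_1)
    then show "norm (path_ind n l m \<omega> * (\<Prod>r\<in>J. f r \<omega>) * (\<Prod>r\<in>K. 1 - f r \<omega>)) \<le> 1"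
      using path_ind_bounds[of n l m \<omega>] by (auto simp: abs_mult intro!: mult_le_one)
  qed
qed

text \<open>Since \<open>path_ind\<close> is measurable with respect to the SNRs, it passes through
  the conditional expectation. Conditional independence then factors the probability of joint error,
  and each factor is a \<open>path_PER\<close> on the path.\<close>

lemma expectation_errors:
  assumes "n \<in> {1..N}" "l \<le> Nr" "\<And>k. k \<in> {1..l} \<Longrightarrow> m k \<in> {1..N}"
    "J \<subseteq> {SR, SD} \<union> RD ` {1..l}"
  shows "expectation (\<lambda>\<omega>. path_ind n l m \<omega> * (\<Prod>r\<in>J. indicator (err r) \<omega>)) =
         expectation (\<lambda>\<omega>. path_ind n l m \<omega> * (\<Prod>r\<in>J. path_PER n m r \<omega>))"
\<comment> \<open>\<open>err_cond_indep\<close> speaks of nonempty \<open>J\<close> only; for empty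
  \<open>J\<close> both products are 1.\<close>
proof (cases "J = {}")
  case False
  interpret snr: finite_measure_subalgebra M snr_alg
    by unfold_locales (rule subalgebra_snr_alg)
  have fin: "finite J" using assms(4) by (rule finite_subset) auto
  have Jr: "J \<subseteq> receptions Nr" using assms(4) receptions_subset[OF assms(2)] by blast
  have ev: "err r \<in> events" if "r \<in> J" for r using that Jr err_events by blast
  have int_ev: "(\<Inter>r\<in>J. err r) \<in> events" using fin False ev by (intro sets.finite_INT) auto
  have pr: "(\<Prod>r\<in>J. indicator (err r) \<omega>) = (indicator (\<Inter>r\<in>J. err r) \<omega> :: real)" for \<omega>
    using fin by (auto simp: indicator_def)
  have intg: "integrable M (\<lambda>\<omega>. path_ind n l m \<omega> * indicator (\<Inter>r\<in>J. err r) \<omega>)"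
    using integrable_bounded_prod[OF assms(2) fin, of "{}" "\<lambda>r. indicator (err r)" n m] ev
    by (simp add: pr)
  have "AE \<omega> in M. \<forall>r\<in>J. path_ind n l m \<omega> \<noteq> 0 \<longrightarrow>
           real_cond_exp M snr_alg (indicator (err r)) \<omega> = path_PER n m r \<omega>"
    using assms fin by (intro AE_finite_allI cond_error_prob) auto
  \<comment> \<open>Off the path both sides are 0, so the factors need to agree only where
    \<open>path_ind\<close> is nonzero.\<close>
  then have "AE \<omega> in M. path_ind n l m \<omega> * real_cond_exp M snr_alg (indicator (\<Inter>r\<in>J. err r)) \<omega> =
      path_ind n l m \<omega> * (\<Prod>r\<in>J. path_PER n m r \<omega>)"
    using err_cond_indep[OF Jr False]
    by eventually_elim (auto intro!: prod.cong)
  note AE = this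
  have "expectation (\<lambda>\<omega>. path_ind n l m \<omega> * (\<Prod>r\<in>J. indicator (err r) \<omega>)) =
      expectation (\<lambda>\<omega>. path_ind n l m \<omega> * real_cond_exp M snr_alg (indicator (\<Inter>r\<in>J. err r)) \<omega>)"
    unfolding pr
    by (rule snr.real_cond_exp_intg(2)[symmetric, OF intg path_ind_measurable_snr_alg[OF assms(2)]])
      (use int_ev in measurable)
  also have "\<dots> = expectation (\<lambda>\<omega>. path_ind n l m \<omega> * (\<Prod>r\<in>J. path_PER n m r \<omega>))"
    using AE assms Jr fin
    by (intro integral_cong_AE borel_measurable_times borel_measurable_prod path_PER_measurable[of _ l]
          path_ind_measurable measurable_from_subalg[OF subalgebra_snr_alg borel_measurable_cond_exp]) auto
  finally show ?thesis .
qed simp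

text \<open>Conditional independence is given for intersections of error events only. Expanding one
  success factor \<open>1 - f r\<close> by linearity moves \<open>r\<close> into the error set with
  a minus sign, so induction on \<open>K\<close> with \<open>J\<close> arbitrary reduces the claim
  to \<open>expectation_errors\<close>.\<close>

lemma expectation_errors_successes:
  assumes "n \<in> {1..N}" "l \<le> Nr" "\<And>k. k \<in> {1..l} \<Longrightarrow> m k \<in> {1..N}"
    and "finite K" "J \<union> K \<subseteq> {SR, SD} \<union> RD ` {1..l}" "J \<inter> K = {}"
  shows "expectation (\<lambda>\<omega>. path_ind n l m \<omega> * (\<Prod>r\<in>J. indicator (err r) \<omega>) * (\<Prod>r\<in>K. 1 - indicator (err r) \<omega>)) =
         expectation (\<lambda>\<omega>. path_ind n l m \<omega> * (\<Prod>r\<in>J. path_PER n m r \<omega>) * (\<Prod>r\<in>K. 1 - path_PER n m r \<omega>))"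
  using assms(4-6)
proof (induction K arbitrary: J rule: finite_induct)
  case empty
  then show ?case using expectation_errors[OF assms(1-3)] by simp
next
  case (insert r K)
  have fin: "finite J" by (rule finite_subset[of _ "{SR, SD} \<union> RD ` {1..l}"]) (use insert in auto)
  \<comment> \<open>The expansion is applied twice, to the error indicators and to
    \<open>path_PER\<close>, hence the general \<open>f\<close>.\<close>
  have split: "expectation (\<lambda>\<omega>. path_ind n l m \<omega> * (\<Prod>r\<in>J. f r \<omega>) * (\<Prod>r\<in>insert r K. 1 - f r \<omega>)) =
      expectation (\<lambda>\<omega>. path_ind n l m \<omega> * (\<Prod>r\<in>J. f r \<omega>) * (\<Prod>r\<in>K. 1 - f r \<omega>)) -
      expectation (\<lambda>\<omega>. path_ind n l m \<omega> * (\<Prod>r\<in>insert r J. f r \<omega>) * (\<Prod>r\<in>K. 1 - f r \<omega>))"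
    if f: "\<And>r. r \<in> {SR, SD} \<union> RD ` {1..l} \<Longrightarrow> f r \<in> borel_measurable M"
        "\<And>r \<omega>. r \<in> {SR, SD} \<union> RD ` {1..l} \<Longrightarrow> f r \<omega> \<in> {0..1}" for f :: "reception \<Rightarrow> 'w \<Rightarrow> real"
  proof -
    have "r \<notin> J" using insert by auto
    then have "expectation (\<lambda>\<omega>. path_ind n l m \<omega> * (\<Prod>r\<in>J. f r \<omega>) * (\<Prod>r\<in>insert r K. 1 - f r \<omega>)) =
      expectation (\<lambda>\<omega>. path_ind n l m \<omega> * (\<Prod>r\<in>J. f r \<omega>) * (\<Prod>r\<in>K. 1 - f r \<omega>) -
        path_ind n l m \<omega> * (\<Prod>r\<in>insert r J. f r \<omega>) * (\<Prod>r\<in>K. 1 - f r \<omega>))"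
      using insert.hyps fin by (intro Bochner_Integration.integral_cong) (auto simp: algebra_simps)
    also have "\<dots> = expectation (\<lambda>\<omega>. path_ind n l m \<omega> * (\<Prod>r\<in>J. f r \<omega>) * (\<Prod>r\<in>K. 1 - f r \<omega>)) -
      expectation (\<lambda>\<omega>. path_ind n l m \<omega> * (\<Prod>r\<in>insert r J. f r \<omega>) * (\<Prod>r\<in>K. 1 - f r \<omega>))"
      using insert.prems insert.hyps fin
      by (intro Bochner_Integration.integral_diff integrable_bounded_prod assms(2) f) auto
    finally show ?thesis .
  qed
  have ev: "(indicator (err r) :: 'w \<Rightarrow> real) \<in> borel_measurable M" if "r \<in> {SR, SD} \<union> RD ` {1..l}" for r
    using that receptions_subset[OF assms(2)] err_events by (intro borel_measurable_indicator) auto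
  have "expectation (\<lambda>\<omega>. path_ind n l m \<omega> * (\<Prod>r\<in>J. indicator (err r) \<omega>) * (\<Prod>r\<in>K. 1 - indicator (err r) \<omega>)) =
         expectation (\<lambda>\<omega>. path_ind n l m \<omega> * (\<Prod>r\<in>J. path_PER n m r \<omega>) * (\<Prod>r\<in>K. 1 - path_PER n m r \<omega>))"
    using insert by (intro insert.IH) auto
  moreover have "expectation (\<lambda>\<omega>. path_ind n l m \<omega> * (\<Prod>r\<in>insert r J. indicator (err r) \<omega>) * (\<Prod>r\<in>K. 1 - indicator (err r) \<omega>)) =
         expectation (\<lambda>\<omega>. path_ind n l m \<omega> * (\<Prod>r\<in>insert r J. path_PER n m r \<omega>) * (\<Prod>r\<in>K. 1 - path_PER n m r \<omega>))"
    using insert by (intro insert.IH) auto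
  moreover have "expectation (\<lambda>\<omega>. path_ind n l m \<omega> * (\<Prod>r\<in>J. path_PER n m r \<omega>) * (\<Prod>r\<in>insert r K. 1 - path_PER n m r \<omega>)) =
      expectation (\<lambda>\<omega>. path_ind n l m \<omega> * (\<Prod>r\<in>J. path_PER n m r \<omega>) * (\<Prod>r\<in>K. 1 - path_PER n m r \<omega>)) -
      expectation (\<lambda>\<omega>. path_ind n l m \<omega> * (\<Prod>r\<in>insert r J. path_PER n m r \<omega>) * (\<Prod>r\<in>K. 1 - path_PER n m r \<omega>))"
  proof (rule split)
    show "path_PER n m r \<in> borel_measurable M" if "r \<in> {SR, SD} \<union> RD ` {1..l}" for r
      using assms(1-3) that by (rule path_PER_measurable)
    show "path_PER n m r \<omega> \<in> {0..1}" if "r \<in> {SR, SD} \<union> RD ` {1..l}" for r \<omega>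
      using assms(1,3) that by (rule path_PER_range)
  qed
  moreover have "expectation (\<lambda>\<omega>. path_ind n l m \<omega> * (\<Prod>r\<in>J. indicator (err r) \<omega>) * (\<Prod>r\<in>insert r K. 1 - indicator (err r) \<omega>)) =
      expectation (\<lambda>\<omega>. path_ind n l m \<omega> * (\<Prod>r\<in>J. indicator (err r) \<omega>) * (\<Prod>r\<in>K. 1 - indicator (err r) \<omega>)) -
      expectation (\<lambda>\<omega>. path_ind n l m \<omega> * (\<Prod>r\<in>insert r J. indicator (err r) \<omega>) * (\<Prod>r\<in>K. 1 - indicator (err r) \<omega>))"
    by (rule split, rule ev, assumption) (auto simp: indicator_def)
  ultimately show ?case by linarith
qed

section \<open>Factorisation over the independent SNRs\<close>

lemma expectation_prod_snr:
  fixes u :: "nat \<Rightarrow> real \<Rightarrow> real"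
  assumes "l \<le> Nr" "\<And>k. k \<le> l \<Longrightarrow> u k \<in> borel_measurable borel" "\<And>k x. k \<le> l \<Longrightarrow> u k x \<in> {0..1}"
  shows "expectation (\<lambda>\<omega>. \<Prod>k\<in>{0..l}. u k (snr k \<omega>)) =
    (\<Prod>k\<in>{0..l}. expectation (\<lambda>\<omega>. u k (snr k \<omega>)))"
proof (rule indep_vars_lebesgue_integral)
  show "indep_vars (\<lambda>_. borel) (\<lambda>k \<omega>. u k (snr k \<omega>)) {0..l}"
    using assms by (intro indep_vars_compose2[OF indep_vars_subset[OF snr_indep]]) auto
  fix k assume k: "k \<in> {0..l}"
  then have "(\<lambda>\<omega>. u k (snr k \<omega>)) \<in> borel_measurable M"
    using assms by (intro measurable_compose[OF snr_measurable]) auto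
  then show "integrable M (\<lambda>\<omega>. u k (snr k \<omega>))"
    using assms(3)[of k] k by (intro integrable_const_bound[where B=1]) auto
qed simp

text \<open>Density and thresholds are left general to serve both the source link and every relay
  retransmission.\<close>

lemma expectation_mode_PER:
  assumes "distributed M lborel X (\<lambda>x. ennreal (p x))" "\<And>x. 0 \<le> p x" "n \<in> {1..N}"
  shows "expectation (\<lambda>\<omega>. indicator (snr_interval th n) (X \<omega>) * PER n (X \<omega>)) =
    avg_PER p th PER n * mode_prob p th n"
  using expectation_density[OF assms(1,2), of "\<lambda>x. indicator (snr_interval th n) x * PER n x"]
    PER_measurable[OF assms(3)] mode_prob_mult_avg_PER[OF assms(2) density_integrable[OF assms(1,2)], of th]
  by (simp add: set_lebesgue_integral_def ac_simps)

lemma expectation_mode_success: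
  assumes "distributed M lborel X (\<lambda>x. ennreal (p x))" "\<And>x. 0 \<le> p x" "n \<in> {1..N}"
  shows "expectation (\<lambda>\<omega>. indicator (snr_interval th n) (X \<omega>) * (1 - PER n (X \<omega>))) =
    (1 - avg_PER p th PER n) * mode_prob p th n"
proof -
  have X [measurable]: "X \<in> borel_measurable M" using assms(1) by (auto simp: distributed_def)
  note [measurable] = measurable_compose[OF X PER_measurable[OF assms(3)]]
  have "expectation (\<lambda>\<omega>. indicator (snr_interval th n) (X \<omega>) * (1 - PER n (X \<omega>))) =
    expectation (\<lambda>\<omega>. indicator (snr_interval th n) (X \<omega>)) -
    expectation (\<lambda>\<omega>. indicator (snr_interval th n) (X \<omega>) * PER n (X \<omega>))"
    unfolding right_diff_distrib mult_1_right
    using PER_range[OF assms(3)]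
    by (intro Bochner_Integration.integral_diff integrable_const_bound[where B=1] AE_I2) (auto simp: indicator_def)
  then show ?thesis unfolding expectation_mode[OF assms(1,2)] expectation_mode_PER[OF assms] by (simp add: left_diff_distrib)
qed

text \<open>
  For \<open>l \<ge> 1\<close>, exactly \<open>l\<close> retransmissions are made iff the receptions in \<open>failed l\<close> fail and those in
  \<open>succeeded l\<close> succeed; the outcome of the last possible retransmission \<open>RD Nr\<close> is irrelevant. For
  \<open>l = 0\<close> the two sets describe the complement: some retransmission is made.
\<close>
definition failed :: "nat \<Rightarrow> reception set" where
  "failed l = insert SD (RD ` {1..<l})"

definition succeeded :: "nat \<Rightarrow> reception set" where
  "succeeded l = insert SR (if l \<in> {1..<Nr} then {RD l} else {})"

definition relayed :: "nat \<Rightarrow> 'w \<Rightarrow> real" where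
  "relayed l \<omega> = (\<Prod>r\<in>failed l. indicator (err r) \<omega>) * (\<Prod>r\<in>succeeded l. 1 - indicator (err r) \<omega>)"

text \<open>Meant for \<open>1 \<le> k \<le> l\<close>, as the contribution of the
  \<open>k\<close>-th of exactly \<open>l\<close> retransmissions: an error for
  \<open>k < l\<close>, a success for \<open>k = l < Nr\<close>, and either outcome for
  \<open>k = l = Nr\<close>, where only the mode probability remains.\<close>

definition rd_factor :: "nat \<Rightarrow> (nat \<Rightarrow> nat) \<Rightarrow> nat \<Rightarrow> real" where
  "rd_factor l m k =
     (if k < l then avg_PER p2 th2 PER (m k) else if k < Nr then 1 - avg_PER p2 th2 PER (m k) else 1) *
     mode_prob p2 th2 (m k)"

text \<open>After conditioning, every factor depends on at most one SNR, and independence splits the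
  expectation. The case \<open>l = 0\<close> is included because \<open>stops_after 0\<close> is a
  complement of \<open>relayed 0\<close>.\<close>

lemma expectation_path_relayed:
  assumes "n \<in> {1..N}" "l \<le> Nr" "\<And>k. k \<in> {1..l} \<Longrightarrow> m k \<in> {1..N}"
  shows "expectation (\<lambda>\<omega>. path_ind n l m \<omega> * relayed l \<omega>) =
    (1 - PER n \<gamma>sr) * avg_PER p1 th1 PER n * mode_prob p1 th1 n * (\<Prod>k=1..l. rd_factor l m k)"
proof -
  \<comment> \<open>\<open>u k\<close> collects all factors that depend on the \<open>k\<close>-th
    SNR; the constant success probability of the source-relay reception is put into
    \<open>u 0\<close>.\<close>
  define u :: "nat \<Rightarrow> real \<Rightarrow> real" where
    "u k x = (if k = 0 then indicator (snr_interval th1 n) x * PER n x * (1 - PER n \<gamma>sr)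
       else indicator (snr_interval th2 (m k)) x *
         (if k < l then PER (m k) x else if k < Nr then 1 - PER (m k) x else 1))" for k x
  have "expectation (\<lambda>\<omega>. path_ind n l m \<omega> * relayed l \<omega>) =
      expectation (\<lambda>\<omega>. path_ind n l m \<omega> * (\<Prod>r\<in>failed l. path_PER n m r \<omega>) * (\<Prod>r\<in>succeeded l. 1 - path_PER n m r \<omega>))"
    unfolding relayed_def mult.assoc[symmetric]
    by (rule expectation_errors_successes[OF assms]) (auto simp: failed_def succeeded_def)
  also have "\<dots> = expectation (\<lambda>\<omega>. \<Prod>k\<in>{0..l}. u k (snr k \<omega>))"
  proof (rule Bochner_Integration.integral_cong)
    fix \<omega>
    have J: "(\<Prod>r\<in>failed l. path_PER n m r \<omega>) = PER n (\<gamma>1 \<omega>) * (\<Prod>k=1..<l. PER (m k) (\<gamma>2 k \<omega>))"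
      unfolding failed_def by (subst prod.insert) (auto simp: prod.reindex inj_on_def path_PER_def)
    have K: "(\<Prod>r\<in>succeeded l. 1 - path_PER n m r \<omega>) =
        (1 - PER n \<gamma>sr) * (if l \<in> {1..<Nr} then 1 - PER (m l) (\<gamma>2 l \<omega>) else 1)"
      unfolding succeeded_def by (auto simp: path_PER_def)
    have 0: "{0..l} = insert 0 {1..l}" by auto
    have U: "(\<Prod>k\<in>{0..l}. u k (snr k \<omega>)) = u 0 (\<gamma>1 \<omega>) * (\<Prod>k=1..l. u k (\<gamma>2 k \<omega>))"
      unfolding 0 by (subst prod.insert) (auto simp: packet_snr_def intro!: prod.cong)
    have "(\<Prod>k=1..l. u k (\<gamma>2 k \<omega>)) = (\<Prod>k=1..l. indicator (snr_interval th2 (m k)) (\<gamma>2 k \<omega>)) *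
       (\<Prod>k=1..l. if k < l then PER (m k) (\<gamma>2 k \<omega>) else if k < Nr then 1 - PER (m k) (\<gamma>2 k \<omega>) else 1)"
      by (simp add: u_def flip: prod.distrib)
    \<comment> \<open>Only the last index \<open>l\<close> differs from the earlier ones. For
      \<open>l = 0\<close> both products are empty and the condition on the right is false.\<close>
    moreover have "(\<Prod>k=1..l. if k < l then PER (m k) (\<gamma>2 k \<omega>) else if k < Nr then 1 - PER (m k) (\<gamma>2 k \<omega>) else 1) =
       (\<Prod>k=1..<l. PER (m k) (\<gamma>2 k \<omega>)) * (if l \<in> {1..<Nr} then 1 - PER (m l) (\<gamma>2 l \<omega>) else 1)"
    proof (cases "l = 0")
      case False
      then have "{1..l} = insert l {1..<l}" by auto
      then show ?thesis using False by simp
    qed simp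
    ultimately show "path_ind n l m \<omega> * (\<Prod>r\<in>failed l. path_PER n m r \<omega>) * (\<Prod>r\<in>succeeded l. 1 - path_PER n m r \<omega>) =
      (\<Prod>k\<in>{0..l}. u k (snr k \<omega>))"
      unfolding J K U path_ind_def by (simp add: u_def[of 0])
  qed simp
  also have "\<dots> = (\<Prod>k\<in>{0..l}. expectation (\<lambda>\<omega>. u k (snr k \<omega>)))"
  proof (rule expectation_prod_snr[OF assms(2)])
    fix k assume k: "k \<le> l"
    note [measurable] = PER_measurable[OF assms(1)]
    have [measurable]: "PER (m k) \<in> borel_measurable borel" if "k \<noteq> 0"
      using that k by (intro PER_measurable assms) auto
    show "u k \<in> borel_measurable borel" unfolding u_def[abs_def] by (cases "k = 0") simp_all
    show "u k x \<in> {0..1}" for x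
      using PER_range[OF assms(1)] PER_range[OF assms(3)[of k]] k unfolding u_def
      by (cases "k = 0") (auto simp: indicator_def intro!: mult_le_one)
  qed
  also have "\<dots> = expectation (\<lambda>\<omega>. u 0 (\<gamma>1 \<omega>)) * (\<Prod>k=1..l. expectation (\<lambda>\<omega>. u k (\<gamma>2 k \<omega>)))"
  proof -
    have 0: "{0..l} = insert 0 {1..l}" by auto
    show ?thesis unfolding 0 by (subst prod.insert) (auto simp: packet_snr_def intro!: prod.cong)
  qed
  also have "expectation (\<lambda>\<omega>. u 0 (\<gamma>1 \<omega>)) = (1 - PER n \<gamma>sr) * avg_PER p1 th1 PER n * mode_prob p1 th1 n"
    using expectation_mode_PER[OF snr_sd_distributed density_sd_nonneg assms(1), of th1]
    by (simp add: u_def mult.commute)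
  also have "(\<Prod>k=1..l. expectation (\<lambda>\<omega>. u k (\<gamma>2 k \<omega>))) = (\<Prod>k=1..l. rd_factor l m k)"
  proof (rule prod.cong)
    fix k assume k: "k \<in> {1..l}"
    then have d: "distributed M lborel (\<gamma>2 k) (\<lambda>x. ennreal (p2 x))"
      using assms by (intro snr_rd_distributed) auto
    show "expectation (\<lambda>\<omega>. u k (\<gamma>2 k \<omega>)) = rd_factor l m k"
      using expectation_mode[OF d density_rd_nonneg] expectation_mode_PER[OF d density_rd_nonneg assms(3)[OF k]]
        expectation_mode_success[OF d density_rd_nonneg assms(3)[OF k]] k
      by (simp add: u_def rd_factor_def)
  qed simp
  finally show ?thesis .
qed

section \<open>Integrability and expectation of the path terms\<close>

definition stops_after :: "nat \<Rightarrow> 'w \<Rightarrow> real" where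
  "stops_after l \<omega> = (if l = 0 then 1 - relayed 0 \<omega> else relayed l \<omega>)"

lemma integrable_path_relayed:
  assumes "l \<le> Nr"
  shows "integrable M (\<lambda>\<omega>. path_ind n l m \<omega> * relayed l \<omega>)"
proof -
  have "failed l \<union> succeeded l \<subseteq> {SR, SD} \<union> RD ` {1..l}" by (auto simp: failed_def succeeded_def)
  then have "failed l \<union> succeeded l \<subseteq> receptions Nr" using receptions_subset[OF assms] by blast
  then show ?thesis unfolding relayed_def mult.assoc[symmetric]
    by (intro integrable_bounded_prod borel_measurable_indicator err_events assms)
       (auto simp: failed_def succeeded_def)
qed

lemma integrable_path:
  assumes "l \<le> Nr"
  shows "integrable M (path_ind n l m)"
  using integrable_bounded_prod[OF assms, of "{}" "{}"] by simp

lemma integrable_path_stops: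
  assumes "l \<le> Nr"
  shows "integrable M (\<lambda>\<omega>. path_ind n l m \<omega> * stops_after l \<omega>)"
proof (cases "l = 0")
  case True
  then show ?thesis
    using Bochner_Integration.integrable_diff[OF integrable_path[OF assms] integrable_path_relayed[OF assms], of n m n m]
    by (simp add: stops_after_def right_diff_distrib)
qed (use integrable_path_relayed[OF assms] in \<open>simp add: stops_after_def\<close>)

lemma expectation_path_stops_0:
  assumes "n \<in> {1..N}"
  shows "expectation (\<lambda>\<omega>. path_ind n 0 m \<omega> * stops_after 0 \<omega>) =
    (1 - (1 - PER n \<gamma>sr) * avg_PER p1 th1 PER n) * mode_prob p1 th1 n"
proof -
  have "expectation (\<lambda>\<omega>. path_ind n 0 m \<omega> * stops_after 0 \<omega>) =
      expectation (path_ind n 0 m) - expectation (\<lambda>\<omega>. path_ind n 0 m \<omega> * relayed 0 \<omega>)"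
    using Bochner_Integration.integral_diff[OF integrable_path[of 0 n m] integrable_path_relayed[of 0 n m]]
    by (simp add: stops_after_def right_diff_distrib)
  also have "expectation (path_ind n 0 m) = mode_prob p1 th1 n"
    using expectation_mode[OF snr_sd_distributed density_sd_nonneg, of th1 n]
    by (simp add: path_ind_def[abs_def])
  finally show ?thesis using expectation_path_relayed[OF assms, of 0 m] by (simp add: algebra_simps)
qed

section \<open>The retransmissions made, and the decomposition for a fixed outcome\<close>

lemma retransmissions_eq_interval: "\<exists>l\<le>Nr. retransmissions Nr err \<omega> = {1..l}"
proof -
  let ?S = "retransmissions Nr err \<omega>"
  have fin: "finite ?S" by (simp add: retransmissions_def)
  show ?thesis
  proof (cases "?S = {}")
    case True
    then show ?thesis by (intro exI[of _ 0]) auto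
  next
    case False
    define l where "l = Max ?S"
    have l: "l \<in> ?S" using False fin unfolding l_def by (intro Max_in)
    have "k \<in> {1..l}" if "k \<in> ?S" for k
    proof -
      have "1 \<le> k" using that by (simp add: retransmissions_def)
      moreover have "k \<le> l" using fin that unfolding l_def by (rule Max_ge)
      ultimately show ?thesis by simp
    qed
    \<comment> \<open>Membership is inherited by smaller indices, since it demands the failure of
      the earlier retransmissions only.\<close>
    moreover have "k \<in> ?S" if "k \<in> {1..l}" for k
      using l that by (simp add: retransmissions_def)
    ultimately have "?S = {1..l}" by blast
    moreover have "l \<le> Nr" using l by (simp add: retransmissions_def)
    ultimately show ?thesis by blast
  qed
qed

lemma relayed_eq:
  "relayed l \<omega> = of_bool (\<omega> \<in> err SD \<and> \<omega> \<notin> err SR \<and> (\<forall>k\<in>{1..<l}. \<omega> \<in> err (RD k)) \<and>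
     (l \<in> {1..<Nr} \<longrightarrow> \<omega> \<notin> err (RD l)))"
proof -
  have "finite (failed l)" "finite (succeeded l)" by (simp_all add: failed_def succeeded_def)
  note prod = prod_indicator_eq(1)[OF this(1)] prod_indicator_eq(2)[OF this(2)]
  have J: "(\<forall>r\<in>failed l. \<omega> \<in> err r) \<longleftrightarrow> \<omega> \<in> err SD \<and> (\<forall>k\<in>{1..<l}. \<omega> \<in> err (RD k))"
    by (simp add: failed_def)
  have K: "(\<forall>r\<in>succeeded l. \<omega> \<notin> err r) \<longleftrightarrow> \<omega> \<notin> err SR \<and> (l \<in> {1..<Nr} \<longrightarrow> \<omega> \<notin> err (RD l))"
    by (auto simp: succeeded_def)
  show ?thesis
    unfolding relayed_def prod J K of_bool_conj[symmetric] by (intro arg_cong[of _ _ of_bool]) blast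
qed

text \<open>This ties the product form to the protocol. As the retransmissions made form an interval
  \<open>{1..l'}\<close>, whether \<open>l' = l\<close> is decided by whether the
  \<open>l\<close>-th and the next retransmission belong to it.\<close>

lemma stops_after_eq:
  assumes "l \<le> Nr"
  shows "stops_after l \<omega> = of_bool (retransmissions Nr err \<omega> = {1..l})"
proof -
  let ?S = "retransmissions Nr err \<omega>"
  obtain l' where l': "l' \<le> Nr" "?S = {1..l'}" using retransmissions_eq_interval by blast
  have mem: "k \<le> l' \<longleftrightarrow> k \<le> Nr \<and> \<omega> \<in> err SD \<and> \<omega> \<notin> err SR \<and> (\<forall>j\<in>{1..<k}. \<omega> \<in> err (RD j))" if "1 \<le> k" for k
  proof -
    have "k \<le> l' \<longleftrightarrow> k \<in> ?S" using that unfolding l'(2) by simp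
    also have "\<dots> \<longleftrightarrow> k \<le> Nr \<and> \<omega> \<in> err SD \<and> \<omega> \<notin> err SR \<and> (\<forall>j\<in>{1..<k}. \<omega> \<in> err (RD j))"
      using that unfolding retransmissions_def by simp
    finally show ?thesis .
  qed
  have eq: "?S = {1..l} \<longleftrightarrow> l' = l" unfolding l'(2) by (auto simp: Icc_eq_Icc)
  show ?thesis
  proof (cases "l = 0")
    case True
    \<comment> \<open>No retransmission is made iff the first is not; as \<open>1 \<le> Nr\<close>,
      the first is made exactly when D fails and R succeeds.\<close>
    have "l' = l \<longleftrightarrow> \<not> 1 \<le> l'" using True by auto
    also have "\<dots> \<longleftrightarrow> \<not> (\<omega> \<in> err SD \<and> \<omega> \<notin> err SR)" unfolding mem[OF order_refl] using Nr_ge_1 by simp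
    finally show ?thesis unfolding eq using True by (simp add: stops_after_def relayed_eq)
  next
    case False
    \<comment> \<open>At \<open>l = Nr\<close> the bound \<open>l' \<le> Nr\<close> already excludes
      a further retransmission, so success of \<open>RD l\<close> is demanded only for
      \<open>l < Nr\<close>.\<close>
    have "l' = l \<longleftrightarrow> l \<le> l' \<and> (l < Nr \<longrightarrow> \<not> Suc l \<le> l')" using l' assms by auto
    also have "\<dots> \<longleftrightarrow> \<omega> \<in> err SD \<and> \<omega> \<notin> err SR \<and> (\<forall>k\<in>{1..<l}. \<omega> \<in> err (RD k)) \<and>
        (l \<in> {1..<Nr} \<longrightarrow> \<omega> \<notin> err (RD l))"
    proof (cases "l < Nr")
      case True
      define Q where "Q \<longleftrightarrow> (\<forall>k\<in>{1..<l}. \<omega> \<in> err (RD k))"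
      have "{1..<Suc l} = insert l {1..<l}" using False by auto
      then have "Suc l \<le> l' \<longleftrightarrow> \<omega> \<in> err SD \<and> \<omega> \<notin> err SR \<and> \<omega> \<in> err (RD l) \<and> Q"
        using mem[of "Suc l"] True by (simp add: Q_def)
      moreover have "l \<le> l' \<longleftrightarrow> \<omega> \<in> err SD \<and> \<omega> \<notin> err SR \<and> Q"
        using mem[of l] False assms by (simp add: Q_def)
      moreover have "l \<in> {1..<Nr}" using True False by simp
      ultimately show ?thesis unfolding Q_def[symmetric] using True by blast
    next
      case False
      then show ?thesis using \<open>l \<noteq> 0\<close> mem[of l] assms by simp
    qed
    finally show ?thesis unfolding eq using False by (simp add: stops_after_def relayed_eq)
  qed
qed

text \<open>Away from outage all rates are positive, so the extended arithmetic reduces to real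
  arithmetic and \<open>NP\<close> cancels.\<close>

lemma efficiency_on_rates:
  assumes "n \<in> {1..N}" "\<And>k. k \<in> {1..l} \<Longrightarrow> m k \<in> {1..N}"
  shows "enn2real (ennreal (real NP) / (ennreal (real NP) / ennreal (R n) +
      (\<Sum>k=1..l. ennreal (real NP) / ennreal (R (m k))))) = 1 / symbols_per_bit R n l m"
proof -
  have "(\<Sum>k=1..l. ennreal (real NP) / ennreal (R (m k))) = (\<Sum>k=1..l. ennreal (real NP / R (m k)))"
    using rate_pos[OF assms(2)] by (intro sum.cong) (simp_all add: divide_ennreal)
  also have "\<dots> = ennreal (\<Sum>k=1..l. real NP / R (m k))"
    using rate_pos[OF assms(2)] by (intro sum_ennreal) (simp add: less_imp_le)
  finally have s: "(\<Sum>k=1..l. ennreal (real NP) / ennreal (R (m k))) = ennreal (\<Sum>k=1..l. real NP / R (m k))" .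
  have nn: "0 \<le> (\<Sum>k=1..l. 1 / R (m k))"
    using rate_pos[OF assms(2)] by (intro sum_nonneg) (simp add: less_imp_le)
  then have pos: "0 < symbols_per_bit R n l m"
    unfolding symbols_per_bit_def using rate_pos[OF assms(1)] by (intro add_pos_nonneg) auto
  have "real NP / R n + (\<Sum>k=1..l. real NP / R (m k)) = real NP * symbols_per_bit R n l m"
    by (simp add: symbols_per_bit_def distrib_left sum_distrib_left)
  moreover have "0 \<le> (\<Sum>k=1..l. real NP / R (m k))"
    using rate_pos[OF assms(2)] by (intro sum_nonneg) (simp add: less_imp_le)
  ultimately have "ennreal (real NP) / ennreal (R n) + (\<Sum>k=1..l. ennreal (real NP) / ennreal (R (m k))) =
      ennreal (real NP * symbols_per_bit R n l m)"
    using rate_pos[OF assms(1)] unfolding s by (simp add: divide_ennreal flip: ennreal_plus)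
  then show ?thesis using pos NP_pos by (simp add: divide_ennreal)
qed

text \<open>For a fixed outcome, the number of retransmissions and the modes met single out at most
  one term of the triple sum. None survives if an outage mode is met, and then the efficiency is 0
  too. Nonnegativity puts every SNR into some mode interval.\<close>

lemma efficiency_decomposition:
  assumes "0 \<le> \<gamma>1 \<omega>" "\<And>k. k \<in> {1..Nr} \<Longrightarrow> 0 \<le> \<gamma>2 k \<omega>"
  shows "enn2real (ennreal (real NP) / total_symbols N Nr NP R th1 th2 \<gamma>1 \<gamma>2 err \<omega>) =
    (\<Sum>l=0..Nr. \<Sum>n=1..N. \<Sum>m\<in>{1..l} \<rightarrow>\<^sub>E {1..N}.
       1 / symbols_per_bit R n l m * (path_ind n l m \<omega> * stops_after l \<omega>))"
proof -
  obtain l where l: "l \<le> Nr" "retransmissions Nr err \<omega> = {1..l}" using retransmissions_eq_interval by blast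
  have stop: "stops_after l' \<omega> = of_bool (l' = l)" if "l' \<le> Nr" for l'
    unfolding stops_after_eq[OF that] l(2) by (auto simp: Icc_eq_Icc)
  define n0 where "n0 = mode N th1 (\<gamma>1 \<omega>)"
  \<comment> \<open>Restricting to \<open>{1..l}\<close> makes \<open>m0\<close> extensional, so
    that for a path \<open>m\<close> the equation \<open>m = m0\<close> means agreement of the first
    \<open>l\<close> modes.\<close>
  define m0 where "m0 = (\<lambda>k\<in>{1..l}. mode N th2 (\<gamma>2 k \<omega>))"
  have n0: "n0 \<le> N" using mode_in_snr_interval[OF thresholds_sd assms(1)] by (simp add: n0_def)
  have m0: "m0 k \<le> N" if "k \<in> {1..l}" for k
    using mode_in_snr_interval[OF thresholds_rd assms(2)[of k]] that l(1) by (simp add: m0_def)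
  have path: "path_ind n l m \<omega> = of_bool (n = n0 \<and> m = m0)"
    if n: "n \<in> {1..N}" and m: "m \<in> {1..l} \<rightarrow>\<^sub>E {1..N}" for n m
  proof -
    have 1: "\<gamma>1 \<omega> \<in> snr_interval th1 n \<longleftrightarrow> n = n0"
      using mode_eq_iff[OF thresholds_sd assms(1), of n] n by (auto simp: n0_def)
    have "\<gamma>2 k \<omega> \<in> snr_interval th2 (m k) \<longleftrightarrow> m k = m0 k" if "k \<in> {1..l}" for k
      using mode_eq_iff[OF thresholds_rd assms(2)[of k], of "m k"] PiE_mem[OF m that] that l(1) by (auto simp: m0_def)
    moreover have "m = m0 \<longleftrightarrow> (\<forall>k\<in>{1..l}. m k = m0 k)"
      using m by (auto simp: m0_def fun_eq_iff PiE_def extensional_def)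
    ultimately have 2: "(\<Prod>k=1..l. indicator (snr_interval th2 (m k)) (\<gamma>2 k \<omega>)) = (of_bool (m = m0) :: real)"
      by (auto simp: indicator_def)
    show ?thesis unfolding path_ind_def 2 using 1 by (auto simp: indicator_def)
  qed
  have "(\<Sum>l'=0..Nr. \<Sum>n=1..N. \<Sum>m\<in>{1..l'} \<rightarrow>\<^sub>E {1..N}.
       1 / symbols_per_bit R n l' m * (path_ind n l' m \<omega> * stops_after l' \<omega>)) =
     (\<Sum>l'=0..Nr. if l' = l then \<Sum>n=1..N. \<Sum>m\<in>{1..l} \<rightarrow>\<^sub>E {1..N}. 1 / symbols_per_bit R n l m * path_ind n l m \<omega> else 0)"
    by (intro sum.cong) (simp_all add: stop)
  also have "\<dots> = (\<Sum>n=1..N. \<Sum>m\<in>{1..l} \<rightarrow>\<^sub>E {1..N}. 1 / symbols_per_bit R n l m * path_ind n l m \<omega>)"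
    using l(1) by simp
  also have "\<dots> = (\<Sum>n=1..N. \<Sum>m\<in>{1..l} \<rightarrow>\<^sub>E {1..N}. if n = n0 then if m = m0 then 1 / symbols_per_bit R n0 l m0 else 0 else 0)"
    by (intro sum.cong) (auto simp: path)
  also have "\<dots> = (\<Sum>n=1..N. if n = n0 then \<Sum>m\<in>{1..l} \<rightarrow>\<^sub>E {1..N}. if m = m0 then 1 / symbols_per_bit R n0 l m0 else 0 else 0)"
    by (intro sum.cong) simp_all
  also have "\<dots> = (if n0 \<in> {1..N} \<and> m0 \<in> {1..l} \<rightarrow>\<^sub>E {1..N} then 1 / symbols_per_bit R n0 l m0 else 0)"
    by (simp add: finite_PiE)
  also have "\<dots> = enn2real (ennreal (real NP) / total_symbols N Nr NP R th1 th2 \<gamma>1 \<gamma>2 err \<omega>)"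
  proof -
    have tot: "total_symbols N Nr NP R th1 th2 \<gamma>1 \<gamma>2 err \<omega> =
        ennreal (real NP) / ennreal (R n0) + (\<Sum>k=1..l. ennreal (real NP) / ennreal (R (m0 k)))"
      unfolding total_symbols_def l(2) n0_def by (simp add: m0_def)
    show ?thesis
    proof (cases "n0 \<in> {1..N} \<and> m0 \<in> {1..l} \<rightarrow>\<^sub>E {1..N}")
      case True
      then have "n0 \<in> {1..N}" "\<And>k. k \<in> {1..l} \<Longrightarrow> m0 k \<in> {1..N}" by (auto dest: PiE_mem)
      from efficiency_on_rates[OF this] True show ?thesis unfolding tot by simp
    next
      case False
      \<comment> \<open>All modes met are at most \<open>N\<close>, so the only way to leave the
        index set of the sum is to meet mode 0.\<close>
      have "n0 = 0 \<or> (\<exists>k\<in>{1..l}. m0 k = 0)"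
      proof (rule ccontr)
        assume nz: "\<not> (n0 = 0 \<or> (\<exists>k\<in>{1..l}. m0 k = 0))"
        have "m0 k \<in> {1..N}" if "k \<in> {1..l}" for k
        proof -
          have "m0 k \<noteq> 0" using nz that by auto
          with m0[OF that] show ?thesis by simp
        qed
        moreover have "m0 \<in> extensional {1..l}" by (simp add: m0_def)
        ultimately have "m0 \<in> {1..l} \<rightarrow>\<^sub>E {1..N}" unfolding PiE_def by blast
        with False n0 nz show False by simp
      qed
      \<comment> \<open>Positivity of \<open>NP\<close> matters: in \<open>ennreal\<close> the
        quotient of 0 by 0 is 0, not infinite.\<close>
      moreover have "ennreal (real NP) / ennreal (R 0) = \<top>"
        using NP_pos by (simp add: rate_outage)
      ultimately have "total_symbols N Nr NP R th1 th2 \<gamma>1 \<gamma>2 err \<omega> = \<top>"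
        unfolding tot
      proof (elim disjE bexE)
        fix k assume k: "k \<in> {1..l}" "m0 k = 0" and top: "ennreal (real NP) / ennreal (R 0) = \<top>"
        have "(\<Sum>k=1..l. ennreal (real NP) / ennreal (R (m0 k))) = \<top>"
          unfolding ennreal_sum_eq_top[OF finite_atLeastAtMost] using k top by metis
        then show "ennreal (real NP) / ennreal (R n0) +
            (\<Sum>k=1..l. ennreal (real NP) / ennreal (R (m0 k))) = \<top>" by simp
      qed simp
      then show ?thesis by (subst if_not_P[OF False]) simp
    qed
  qed
  finally show ?thesis ..
qed

text \<open>The decomposition holds only almost everywhere, so measurability of the efficiency does
  not follow from that of the finite sum; it is needed to equate the two expectations.\<close>

lemma efficiency_measurable:
  "(\<lambda>\<omega>. enn2real (ennreal (real NP) / total_symbols N Nr NP R th1 th2 \<gamma>1 \<gamma>2 err \<omega>)) \<in> borel_measurable M"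
proof -
  have sd: "(\<lambda>\<omega>. mode N th1 (\<gamma>1 \<omega>)) \<in> M \<rightarrow>\<^sub>M count_space UNIV"
    by (rule measurable_compose[OF snr_sd_measurable mode_measurable[OF thresholds_sd]])
  have rd: "(\<lambda>\<omega>. mode N th2 (\<gamma>2 k \<omega>)) \<in> M \<rightarrow>\<^sub>M count_space UNIV" if "k \<in> {1..Nr}" for k
    by (rule measurable_compose[OF snr_rd_measurable[OF that] mode_measurable[OF thresholds_rd]])
  have [measurable]: "err SD \<in> events" "err SR \<in> events"
    by (auto intro!: err_events simp: receptions_def)
  \<comment> \<open>The random index set is traded for the fixed range \<open>{1..Nr}\<close> with a
    condition inside, which can be treated term by term.\<close>
  have sum: "(\<Sum>k\<in>retransmissions Nr err \<omega>. ennreal (real NP) / ennreal (R (mode N th2 (\<gamma>2 k \<omega>)))) =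
      (\<Sum>k=1..Nr. if \<omega> \<in> err SD \<and> \<omega> \<notin> err SR \<and> (\<forall>j\<in>{1..<k}. \<omega> \<in> err (RD j))
         then ennreal (real NP) / ennreal (R (mode N th2 (\<gamma>2 k \<omega>))) else 0)" for \<omega>
    unfolding retransmissions_def by (rule sum.inter_filter) simp
  have "(\<lambda>\<omega>. if \<omega> \<in> err SD \<and> \<omega> \<notin> err SR \<and> (\<forall>j\<in>{1..<k}. \<omega> \<in> err (RD j))
         then ennreal (real NP) / ennreal (R (mode N th2 (\<gamma>2 k \<omega>))) else 0) \<in> borel_measurable M"
    if k: "k \<in> {1..Nr}" for k
  proof (rule measurable_If)
    show "(\<lambda>\<omega>. ennreal (real NP) / ennreal (R (mode N th2 (\<gamma>2 k \<omega>)))) \<in> borel_measurable M"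
      by (rule measurable_compose[OF rd[OF k]]) simp
    have [measurable]: "err (RD j) \<in> events" if "j \<in> {1..<k}" for j
      using k that by (auto intro!: err_events simp: receptions_def)
    show "{\<omega> \<in> space M. \<omega> \<in> err SD \<and> \<omega> \<notin> err SR \<and> (\<forall>j\<in>{1..<k}. \<omega> \<in> err (RD j))} \<in> sets M"
      by measurable
  qed simp
  then have "(\<lambda>\<omega>. \<Sum>k\<in>retransmissions Nr err \<omega>.
      ennreal (real NP) / ennreal (R (mode N th2 (\<gamma>2 k \<omega>)))) \<in> borel_measurable M"
    unfolding sum by (rule borel_measurable_sum)
  moreover have "(\<lambda>\<omega>. ennreal (real NP) / ennreal (R (mode N th1 (\<gamma>1 \<omega>)))) \<in> borel_measurable M"
    by (rule measurable_compose[OF sd]) simp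
  ultimately show ?thesis unfolding total_symbols_def by simp
qed

section \<open>Taking expectations and assembling the formula\<close>

lemma avg_spectral_efficiency_eq:
  "avg_spectral_efficiency M N Nr NP R th1 th2 \<gamma>1 \<gamma>2 err =
    (\<Sum>l=0..Nr. \<Sum>n=1..N. \<Sum>m\<in>{1..l} \<rightarrow>\<^sub>E {1..N}.
       1 / symbols_per_bit R n l m * expectation (\<lambda>\<omega>. path_ind n l m \<omega> * stops_after l \<omega>))"
proof -
  define X where "X = (\<lambda>\<omega>. \<Sum>l=0..Nr. \<Sum>n=1..N. \<Sum>m\<in>{1..l} \<rightarrow>\<^sub>E {1..N}.
       1 / symbols_per_bit R n l m * (path_ind n l m \<omega> * stops_after l \<omega>))"
  define Y where "Y = (\<lambda>\<omega>. enn2real (ennreal (real NP) / total_symbols N Nr NP R th1 th2 \<gamma>1 \<gamma>2 err \<omega>))"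
  have "AE \<omega> in M. \<forall>k\<in>{1..Nr}. 0 \<le> \<gamma>2 k \<omega>"
    by (intro AE_finite_allI AE_nonneg_of_density[OF snr_rd_distributed density_rd_support]) auto
  moreover have "AE \<omega> in M. 0 \<le> \<gamma>1 \<omega>"
    by (rule AE_nonneg_of_density[OF snr_sd_distributed density_sd_support])
  ultimately have AE: "AE \<omega> in M. Y \<omega> = X \<omega>"
    unfolding X_def Y_def by eventually_elim (rule efficiency_decomposition, auto)
  have X: "X \<in> borel_measurable M"
    unfolding X_def by (intro borel_measurable_sum borel_measurable_times borel_measurable_const
        borel_measurable_integrable[OF integrable_path_stops]) auto
  have "avg_spectral_efficiency M N Nr NP R th1 th2 \<gamma>1 \<gamma>2 err = expectation Y"
    by (simp add: avg_spectral_efficiency_def Y_def)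
  also have "\<dots> = expectation X"
    using AE X by (intro integral_cong_AE) (auto simp: Y_def intro: efficiency_measurable)
  also have "\<dots> = (\<Sum>l=0..Nr. \<Sum>n=1..N. \<Sum>m\<in>{1..l} \<rightarrow>\<^sub>E {1..N}.
       1 / symbols_per_bit R n l m * expectation (\<lambda>\<omega>. path_ind n l m \<omega> * stops_after l \<omega>))"
    unfolding X_def
    \<comment> \<open>Each round moves the expectation inside one of the three sums; the final
      simplification takes out the constant \<open>1 / symbols_per_bit R n l m\<close>.\<close>
    by (subst Bochner_Integration.integral_sum,
        (intro Bochner_Integration.integrable_sum integrable_mult_right integrable_path_stops; simp),
        intro sum.cong refl)+ simp
  finally show ?thesis .
qed

lemma avg_spectral_efficiency_formula:
  "avg_spectral_efficiency M N Nr NP R th1 th2 \<gamma>1 \<gamma>2 err =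
    (let \<epsilon> = (\<lambda>n. PER n \<gamma>sr);
         L = symbols_per_bit R;
         Psd = mode_prob p1 th1; PERsd = avg_PER p1 th1 PER;
         Prd = mode_prob p2 th2; PERrd = avg_PER p2 th2 PER
     in (\<Sum>n=1..N. (1 - (1 - \<epsilon> n) * PERsd n) / L n 0 (\<lambda>_. undefined) * Psd n)
      + (\<Sum>l=1..Nr-1. \<Sum>n=1..N. \<Sum>m\<in>{1..l} \<rightarrow>\<^sub>E {1..N}.
           (1 - \<epsilon> n) / L n l m * PERsd n * Psd n
             * (\<Prod>k=1..l-1. PERrd (m k) * Prd (m k)) * (1 - PERrd (m l)) * Prd (m l))
      + (\<Sum>n=1..N. \<Sum>m\<in>{1..Nr} \<rightarrow>\<^sub>E {1..N}.
           (1 - \<epsilon> n) * PERsd n * Psd n * Prd (m Nr) / L n Nr m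
             * (\<Prod>k=1..Nr-1. PERrd (m k) * Prd (m k))))"
proof -
  define T where "T l = (\<Sum>n=1..N. \<Sum>m\<in>{1..l} \<rightarrow>\<^sub>E {1..N}.
       1 / symbols_per_bit R n l m * expectation (\<lambda>\<omega>. path_ind n l m \<omega> * stops_after l \<omega>))" for l
  \<comment> \<open>For \<open>l = 0\<close> the only path is \<open>\<lambda>_. undefined\<close>,
    the sole extensional function on the empty set.\<close>
  have T0: "T 0 = (\<Sum>n=1..N. (1 - (1 - PER n \<gamma>sr) * avg_PER p1 th1 PER n) /
      symbols_per_bit R n 0 (\<lambda>_. undefined) * mode_prob p1 th1 n)"
    unfolding T_def by (intro sum.cong) (simp_all add: expectation_path_stops_0)
  \<comment> \<open>The last factor is split off because the first branch of
    \<open>rd_factor\<close> applies exactly to the indices below \<open>l\<close>.\<close>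
  have rd: "(\<Prod>k=1..l. rd_factor l m k) =
      (\<Prod>k=1..l-1. avg_PER p2 th2 PER (m k) * mode_prob p2 th2 (m k)) * rd_factor l m l" if "1 \<le> l" for l m
  proof -
    have "{1..l} = insert l {1..l-1}" using that by auto
    then have "(\<Prod>k=1..l. rd_factor l m k) = (\<Prod>k=1..l-1. rd_factor l m k) * rd_factor l m l"
      using that by (simp add: mult.commute)
    moreover have "(\<Prod>k=1..l-1. rd_factor l m k) =
        (\<Prod>k=1..l-1. avg_PER p2 th2 PER (m k) * mode_prob p2 th2 (m k))"
      by (intro prod.cong) (auto simp: rd_factor_def)
    ultimately show ?thesis by simp
  qed
  have path_term: "1 / symbols_per_bit R n l m * expectation (\<lambda>\<omega>. path_ind n l m \<omega> * stops_after l \<omega>) =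
      (1 - PER n \<gamma>sr) * avg_PER p1 th1 PER n * mode_prob p1 th1 n / symbols_per_bit R n l m
        * ((\<Prod>k=1..l-1. avg_PER p2 th2 PER (m k) * mode_prob p2 th2 (m k)) * rd_factor l m l)"
    if "n \<in> {1..N}" "m \<in> {1..l} \<rightarrow>\<^sub>E {1..N}" "1 \<le> l" "l \<le> Nr" for n m l
  proof -
    have m: "m k \<in> {1..N}" if "k \<in> {1..l}" for k
      using PiE_mem[OF \<open>m \<in> {1..l} \<rightarrow>\<^sub>E {1..N}\<close> that] .
    have "expectation (\<lambda>\<omega>. path_ind n l m \<omega> * stops_after l \<omega>) =
        (1 - PER n \<gamma>sr) * avg_PER p1 th1 PER n * mode_prob p1 th1 n * (\<Prod>k=1..l. rd_factor l m k)"
      using expectation_path_relayed[OF that(1,4) m] that(3) by (simp add: stops_after_def)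
    then show ?thesis unfolding rd[OF that(3)] by (simp only: divide_inverse mult_1_left mult_ac)
  qed
  have Tl: "T l = (\<Sum>n=1..N. \<Sum>m\<in>{1..l} \<rightarrow>\<^sub>E {1..N}.
      (1 - PER n \<gamma>sr) / symbols_per_bit R n l m * avg_PER p1 th1 PER n * mode_prob p1 th1 n
        * (\<Prod>k=1..l-1. avg_PER p2 th2 PER (m k) * mode_prob p2 th2 (m k))
        * (1 - avg_PER p2 th2 PER (m l)) * mode_prob p2 th2 (m l))" if l: "l \<in> {1..Nr-1}" for l
    unfolding T_def
  proof (intro sum.cong refl, goal_cases)
    case (1 n m)
    have "1 \<le> l" "l \<le> Nr" using l by auto
    moreover have "rd_factor l m l = (1 - avg_PER p2 th2 PER (m l)) * mode_prob p2 th2 (m l)"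
      using l by (auto simp: rd_factor_def)
    ultimately show ?case using path_term[OF 1] by (simp only: divide_inverse mult_ac)
  qed
  have TNr: "T Nr = (\<Sum>n=1..N. \<Sum>m\<in>{1..Nr} \<rightarrow>\<^sub>E {1..N}.
      (1 - PER n \<gamma>sr) * avg_PER p1 th1 PER n * mode_prob p1 th1 n * mode_prob p2 th2 (m Nr)
        / symbols_per_bit R n Nr m
        * (\<Prod>k=1..Nr-1. avg_PER p2 th2 PER (m k) * mode_prob p2 th2 (m k)))"
    unfolding T_def
  proof (intro sum.cong refl, goal_cases)
    case (1 n m)
    have "rd_factor Nr m Nr = mode_prob p2 th2 (m Nr)" by (simp add: rd_factor_def)
    then show ?case using path_term[OF 1 Nr_ge_1 order_refl] by (simp only: divide_inverse mult_ac)
  qed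
  \<comment> \<open>The extreme values of \<open>l\<close> give the first and third sums of the
    formula: at 0 nothing is relayed, at \<open>Nr\<close> the last attempt may fail or succeed. For
    \<open>Nr = 1\<close> the middle range is empty.\<close>
  have "{0..Nr} = insert 0 (insert Nr {1..Nr-1})" using Nr_ge_1 by auto
  then have "(\<Sum>l=0..Nr. T l) = T 0 + (\<Sum>l=1..Nr-1. T l) + T Nr" using Nr_ge_1 by simp
  moreover have "(\<Sum>l=1..Nr-1. T l) = (\<Sum>l=1..Nr-1. \<Sum>n=1..N. \<Sum>m\<in>{1..l} \<rightarrow>\<^sub>E {1..N}.
      (1 - PER n \<gamma>sr) / symbols_per_bit R n l m * avg_PER p1 th1 PER n * mode_prob p1 th1 n
        * (\<Prod>k=1..l-1. avg_PER p2 th2 PER (m k) * mode_prob p2 th2 (m k))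
        * (1 - avg_PER p2 th2 PER (m l)) * mode_prob p2 th2 (m l))"
    by (intro sum.cong refl Tl)
  ultimately show ?thesis
    unfolding avg_spectral_efficiency_eq T_def[symmetric] Let_def T0 TNr by simp
qed

end

theorem proposition1:
  fixes M :: "'w measure"
    and N Nr NP :: nat
    and R :: "nat \<Rightarrow> real"
    and th1 th2 :: "nat \<Rightarrow> ereal"
    and p1 p2 :: "real \<Rightarrow> real"
    and PER :: "nat \<Rightarrow> real \<Rightarrow> real"
    and \<gamma>sr :: real
    and \<gamma>1 :: "'w \<Rightarrow> real"
    and \<gamma>2 :: "nat \<Rightarrow> 'w \<Rightarrow> real"
    and err :: "reception \<Rightarrow> 'w set"
  assumes "cooperative_arq M N Nr NP R th1 th2 p1 p2 PER \<gamma>sr \<gamma>1 \<gamma>2 err"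
  shows "avg_spectral_efficiency M N Nr NP R th1 th2 \<gamma>1 \<gamma>2 err =
    (let \<epsilon> = (\<lambda>n. PER n \<gamma>sr);
         L = symbols_per_bit R;
         Psd = mode_prob p1 th1; PERsd = avg_PER p1 th1 PER;
         Prd = mode_prob p2 th2; PERrd = avg_PER p2 th2 PER
     in (\<Sum>n=1..N. (1 - (1 - \<epsilon> n) * PERsd n) / L n 0 (\<lambda>_. undefined) * Psd n)
      + (\<Sum>l=1..Nr-1. \<Sum>n=1..N. \<Sum>m\<in>{1..l} \<rightarrow>\<^sub>E {1..N}.
           (1 - \<epsilon> n) / L n l m * PERsd n * Psd n
             * (\<Prod>k=1..l-1. PERrd (m k) * Prd (m k)) * (1 - PERrd (m l)) * Prd (m l))
      + (\<Sum>n=1..N. \<Sum>m\<in>{1..Nr} \<rightarrow>\<^sub>E {1..N}.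
           (1 - \<epsilon> n) * PERsd n * Psd n * Prd (m Nr) / L n Nr m
             * (\<Prod>k=1..Nr-1. PERrd (m k) * Prd (m k))))"
  using assms by (rule cooperative_arq.avg_spectral_efficiency_formula)

end
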